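(* Let $\Phi : \mathscr{S} \ni s \mapsto T_s \in \mathscr{L}(X)$ be a homomorphism of a strongly [resp. weakly] right amenable SGT $\mathscr{S}$ into $\mathscr{L}(X)$, where $X$ is a Banach space. Suppose $Y$ is a finite-dimensional linear subspace of $X$ and: (fp0) $\Phi$ is continuous in the weak operator topology [resp. strong operator topology] of $\mathscr{L}(X)$; (fp1) for any $s \in \mathscr{S}$, $T_s(Y) = Y$. Then the following conditions are equivalent: (i) there exists a projection $P : X \to Y$ such that $PT_s = T_s P$ for all $s \in \mathscr{S}$; (ii) there is a projection $Q : X \to Y$ such that $\sup_{s \in \mathscr{S}} \|(T_s|_Y)^{-1} Q T_s\| < \infty$. Moreover, if (ii) holds, then there exists a $\Phi$-minimal projection $P_0 : X \to Y$. (The statement consists of two versions: "strongly / weak operator topology" and "weakly / strong operator topology".)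
   Context: An SGT (semigroup with topology) is a non-empty semigroup $\mathscr{S}$ that is also a (possibly non-Hausdorff) topological space; no compatibility between the multiplication and the topology is assumed. For $f:\mathscr{S}\to\mathbb{R}$ and $s\in\mathscr{S}$ let $f_s(t)=f(ts)$. $C_b(\mathscr{S})$ is the space of bounded continuous real-valued functions on $\mathscr{S}$ with the sup-norm, and $C_r(\mathscr{S})=\{f\in C_b(\mathscr{S}): f_s \text{ is continuous for every } s\in\mathscr{S}\}$. Let $C_{norm}(\mathscr{S})$ [resp. $C_{weak}(\mathscr{S})$] be the set of all $f\in C_r(\mathscr{S})$ such that $s\mapsto f_s$ and, for all $t\in\mathscr{S}$, $s\mapsto f_{st}$ are continuous from $\mathscr{S}$ to $C_r(\mathscr{S})$ equipped with its norm [resp. weak] topology. A mean on a linear subspace $\mathscr{F}$ of $C_r(\mathscr{S})$ is a linear functional $\phi:\mathscr{F}\to\mathbb{R}$ with $\inf f(\mathscr{S})\leqslant\phi(f)\leqslant\sup f(\mathscr{S})$ for all $f\in\mathscr{F}$; if $\mathscr{F}$ is right invariant ($f_s\in\mathscr{F}$ for $f\in\mathscr{F}$, $s\in\mathscr{S}$), the mean is right invariant if $\phi(f_s)=\phi(f)$ for all $f\in\mathscr{F}$, $s\in\mathscr{S}$. $\mathscr{S}$ is weakly [resp. strongly] right amenable if there is a right invariant mean on $C_{norm}(\mathscr{S})$ [resp. $C_{weak}(\mathscr{S})$]. Banach spaces are real or complex. $\mathscr{L}(X)$ is the algebra of bounded linear operators on $X$; $s\mapsto T_s$ is a homomorphism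 if $T_{st}=T_sT_t$ for all $s,t$. A projection $P:X\to Y$ is a bounded linear operator with $Py=y$ for all $y\in Y$. A projection $P_0:X\to Y$ is $\Phi$-minimal if $P_0$ commutes with all $T_s$ and $\|P_0\|\leqslant\|P\|$ for any other projection $P:X\to Y$ that commutes with all $T_s$. *)

theory Defs
  imports "HOL-Analysis.Analysis"
begin

section \<open>Real or complex Banach spaces\<close>

text \<open>
  A type of this class is, up to an isometric isomorphism of normed fields, the field of real
  numbers (first disjunct) or the field of complex numbers (second disjunct, where \<open>i\<close> is
  the imaginary unit).  It is used to treat real and complex Banach spaces simultaneously.
\<close>

class real_or_complex = real_normed_field +
  assumes real_or_complex:
    "(\<forall>z::'a. \<exists>a::real. z = a *\<^sub>R 1) \<or>
     (\<exists>i::'a. i * i = - 1 \<and> (\<forall>z. \<exists>a b::real. z = a *\<^sub>R 1 + b *\<^sub>R i) \<and>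
        (\<forall>a b::real. norm (a *\<^sub>R 1 + b *\<^sub>R i) = sqrt (a\<^sup>2 + b\<^sup>2)))"

instance real :: real_or_complex
  by standard simp

instance complex :: real_or_complex
proof
  have "\<i> * \<i> = - 1" by simp
  moreover have "\<exists>a b::real. z = a *\<^sub>R 1 + b *\<^sub>R \<i>" for z
    by (rule exI[of _ "Re z"], rule exI[of _ "Im z"]) (simp add: complex_eq_iff)
  moreover have "norm (a *\<^sub>R 1 + b *\<^sub>R \<i>) = sqrt (a\<^sup>2 + b\<^sup>2)" for a b
    by (simp add: cmod_def)
  ultimately show "(\<forall>z::complex. \<exists>a::real. z = a *\<^sub>R 1) \<or>
     (\<exists>i::complex. i * i = - 1 \<and> (\<forall>z. \<exists>a b::real. z = a *\<^sub>R 1 + b *\<^sub>R i) \<and>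
        (\<forall>a b::real. norm (a *\<^sub>R 1 + b *\<^sub>R i) = sqrt (a\<^sup>2 + b\<^sup>2)))"
    by blast
qed

text \<open>
  The library's class \<open>banach\<close> consists of real Banach spaces.  A Banach space over \<open>'k\<close> is a
  type of this class with a scalar multiplication by \<open>'k\<close> that extends the real one and is
  compatible with the norm.  For \<open>'k = real\<close>, the multiplication is necessarily \<open>scaleR\<close>.
\<close>

definition banach_scaling :: "('k::real_or_complex \<Rightarrow> 'x::banach \<Rightarrow> 'x) \<Rightarrow> bool" where
  "banach_scaling sc \<longleftrightarrow>
     vector_space sc \<and>
     (\<forall>r x. sc (of_real r) x = r *\<^sub>R x) \<and>
     (\<forall>c x. norm (sc c x) = norm c * norm x)"

lemma banach_scaling_scaleR: "banach_scaling (scaleR :: real \<Rightarrow> 'x::banach \<Rightarrow> 'x)"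
  unfolding banach_scaling_def by (simp add: real_vector.vector_space_axioms)

definition finite_dim_subspace :: "('k::real_or_complex \<Rightarrow> 'x::banach \<Rightarrow> 'x) \<Rightarrow> 'x set \<Rightarrow> bool" where
  "finite_dim_subspace sc Y \<longleftrightarrow> (\<exists>B. finite B \<and> module.span sc B = Y)"

text \<open>
  Elements of the library type \<open>'x \<Rightarrow>\<^sub>L 'x\<close> are bounded real-linear; the operators in \<open>\<L>(X)\<close> are
  those that are linear over \<open>'k\<close>.  The operator norm does not depend on the scalar field.
\<close>

definition bounded_ops :: "('k::real_or_complex \<Rightarrow> 'x::banach \<Rightarrow> 'x) \<Rightarrow> ('x \<Rightarrow>\<^sub>L 'x) set" where
  "bounded_ops sc = {A. \<forall>c x. blinfun_apply A (sc c x) = sc c (blinfun_apply A x)}"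

definition dual_space :: "('k::real_or_complex \<Rightarrow> 'x::banach \<Rightarrow> 'x) \<Rightarrow> ('x \<Rightarrow>\<^sub>L 'k) set" where
  "dual_space sc = {f. \<forall>c x. blinfun_apply f (sc c x) = c * blinfun_apply f x}"

definition weak_operator_topology ::
    "('k::real_or_complex \<Rightarrow> 'x::banach \<Rightarrow> 'x) \<Rightarrow> ('x \<Rightarrow>\<^sub>L 'x) topology" where
  "weak_operator_topology sc =
     topology_generated_by
       {{A. blinfun_apply f (blinfun_apply A x) \<in> U} | f x U. f \<in> dual_space sc \<and> open U}"

text \<open>A projection \<open>X \<rightarrow> Y\<close>, regarded as an operator on \<open>X\<close> with values in \<open>Y\<close>.\<close>

definition is_projection ::
    "('k::real_or_complex \<Rightarrow> 'x::banach \<Rightarrow> 'x) \<Rightarrow> 'x set \<Rightarrow> ('x \<Rightarrow>\<^sub>L 'x) \<Rightarrow> bool" where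
  "is_projection sc Y P \<longleftrightarrow>
     P \<in> bounded_ops sc \<and> range (blinfun_apply P) \<subseteq> Y \<and> (\<forall>y\<in>Y. blinfun_apply P y = y)"

definition commutes_with_all :: "('s \<Rightarrow> 'x::banach \<Rightarrow>\<^sub>L 'x) \<Rightarrow> ('x \<Rightarrow>\<^sub>L 'x) \<Rightarrow> bool" where
  "commutes_with_all T P \<longleftrightarrow> (\<forall>s. P o\<^sub>L T s = T s o\<^sub>L P)"

definition minimal_projection ::
    "('k::real_or_complex \<Rightarrow> 'x::banach \<Rightarrow> 'x) \<Rightarrow> ('s \<Rightarrow> 'x \<Rightarrow>\<^sub>L 'x) \<Rightarrow> 'x set \<Rightarrow> ('x \<Rightarrow>\<^sub>L 'x) \<Rightarrow> bool"
  where
  "minimal_projection sc T Y P\<^sub>0 \<longleftrightarrow>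
     is_projection sc Y P\<^sub>0 \<and> commutes_with_all T P\<^sub>0 \<and>
     (\<forall>P. is_projection sc Y P \<and> commutes_with_all T P \<longrightarrow> norm P\<^sub>0 \<le> norm P)"


section \<open>Amenability of semigroups with topology\<close>

text \<open>
  An SGT is a type of sort \<open>{semigroup_mult, topological_space}\<close>; no axiom relates the two
  structures.  The space \<open>C\<^sub>b\<close> of an SGT is the library type \<open>'s \<Rightarrow>\<^sub>C real\<close>, with the sup-norm.
\<close>

definition C_r :: "('s::{semigroup_mult,topological_space} \<Rightarrow>\<^sub>C real) set" where
  "C_r = {f. \<forall>s. continuous_on UNIV (\<lambda>t. apply_bcontfun f (t * s))}"

text \<open>
  The function \<open>f\<^sub>s\<close>.  It is meaningful for \<open>f \<in> C_r\<close> only, since otherwise \<open>f\<^sub>s\<close> need not be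
  continuous and \<open>Bcontfun\<close> is unspecified.
\<close>

definition rtrans ::
    "('s::{semigroup_mult,topological_space} \<Rightarrow>\<^sub>C real) \<Rightarrow> 's \<Rightarrow> ('s \<Rightarrow>\<^sub>C real)" where
  "rtrans f s = Bcontfun (\<lambda>t. apply_bcontfun f (t * s))"

lemma apply_rtrans:
  assumes "f \<in> C_r"
  shows "apply_bcontfun (rtrans f s) t = apply_bcontfun f (t * s)"
proof -
  have "bounded (range (\<lambda>t. apply_bcontfun f (t * s)))"
    by (rule bounded_subset[OF bounded_apply_bcontfun]) auto
  then have "(\<lambda>t. apply_bcontfun f (t * s)) \<in> bcontfun"
    using assms by (simp add: C_r_def bcontfun_def)
  then show ?thesis
    by (simp add: rtrans_def Bcontfun_inverse)
qed

lemma rtrans_in_C_r: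
  assumes "f \<in> C_r"
  shows "rtrans f s \<in> C_r"
  using assms by (simp add: C_r_def apply_rtrans[OF assms] mult.assoc)

text \<open>The functionals in the dual of a linear subspace \<open>V\<close> of a normed space; their values
  outside \<open>V\<close> are irrelevant.\<close>

definition dual_on :: "'v::real_normed_vector set \<Rightarrow> ('v \<Rightarrow> real) set" where
  "dual_on V = {\<phi>.
     (\<forall>u\<in>V. \<forall>v\<in>V. \<phi> (u + v) = \<phi> u + \<phi> v) \<and>
     (\<forall>r. \<forall>v\<in>V. \<phi> (r *\<^sub>R v) = r * \<phi> v) \<and>
     (\<exists>B. \<forall>v\<in>V. \<bar>\<phi> v\<bar> \<le> B * norm v)}"

definition weak_topology_on :: "'v::real_normed_vector set \<Rightarrow> 'v topology" where
  "weak_topology_on V =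
     topology_generated_by {{v \<in> V. \<phi> v \<in> U} | \<phi> U. \<phi> \<in> dual_on V \<and> open U}"

definition C_norm :: "('s::{semigroup_mult,topological_space} \<Rightarrow>\<^sub>C real) set" where
  "C_norm = {f \<in> C_r.
     continuous_map euclidean (top_of_set C_r) (\<lambda>s. rtrans f s) \<and>
     (\<forall>t. continuous_map euclidean (top_of_set C_r) (\<lambda>s. rtrans f (s * t)))}"

definition C_weak :: "('s::{semigroup_mult,topological_space} \<Rightarrow>\<^sub>C real) set" where
  "C_weak = {f \<in> C_r.
     continuous_map euclidean (weak_topology_on C_r) (\<lambda>s. rtrans f s) \<and>
     (\<forall>t. continuous_map euclidean (weak_topology_on C_r) (\<lambda>s. rtrans f (s * t)))}"

definition is_mean ::
    "('s::{semigroup_mult,topological_space} \<Rightarrow>\<^sub>C real) set \<Rightarrow> (('s \<Rightarrow>\<^sub>C real) \<Rightarrow> real) \<Rightarrow> bool" where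
  "is_mean F \<phi> \<longleftrightarrow>
     (\<forall>f\<in>F. \<forall>g\<in>F. \<phi> (f + g) = \<phi> f + \<phi> g) \<and>
     (\<forall>r. \<forall>f\<in>F. \<phi> (r *\<^sub>R f) = r * \<phi> f) \<and>
     (\<forall>f\<in>F. Inf (range (apply_bcontfun f)) \<le> \<phi> f \<and> \<phi> f \<le> Sup (range (apply_bcontfun f)))"

definition right_invariant_mean ::
    "('s::{semigroup_mult,topological_space} \<Rightarrow>\<^sub>C real) set \<Rightarrow> (('s \<Rightarrow>\<^sub>C real) \<Rightarrow> real) \<Rightarrow> bool" where
  "right_invariant_mean F \<phi> \<longleftrightarrow> is_mean F \<phi> \<and> (\<forall>f\<in>F. \<forall>s. \<phi> (rtrans f s) = \<phi> f)"

definition weakly_right_amenable :: "'s::{semigroup_mult,topological_space} itself \<Rightarrow> bool" where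
  "weakly_right_amenable _ \<longleftrightarrow>
     (\<exists>\<phi>. right_invariant_mean (C_norm :: ('s \<Rightarrow>\<^sub>C real) set) \<phi>)"

definition strongly_right_amenable :: "'s::{semigroup_mult,topological_space} itself \<Rightarrow> bool" where
  "strongly_right_amenable _ \<longleftrightarrow>
     (\<exists>\<phi>. right_invariant_mean (C_weak :: ('s \<Rightarrow>\<^sub>C real) set) \<phi>)"

end

theory Submission
  imports Defs
begin

text \<open>
  If \<open>P\<close> is a projection onto \<open>Y\<close> that commutes with every \<open>T\<^sub>s\<close>, then
  \<open>(T\<^sub>s|\<^sub>Y)\<inverse> P T\<^sub>s = P\<close>, so the family in (ii) is constant for \<open>Q = P\<close>.

  Conversely, a projection \<open>Q\<close> as in (ii) is averaged.  Each \<open>T\<^sub>s\<close> is invertible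
  on \<open>Y\<close>, since it maps this finite-dimensional space onto itself.  Put \<open>R\<^sub>s = (T\<^sub>s|\<^sub>Y)\<inverse> Q\<close>, a bounded
  operator on \<open>X\<close>.  For \<open>x\<close> in \<open>X\<close> and a bounded real-linear functional \<open>h\<close>, the orbit function
  \<open>g\<^bsub>x,h\<^esub>(s) = h (R\<^sub>s T\<^sub>s x)\<close> is bounded by (ii).  Since \<open>R\<^bsub>st\<^esub> = R\<^sub>t R\<^sub>s\<close>, right translation
  only moves the parameters: \<open>g\<^bsub>x,h\<^esub>(s t) = g\<^bsub>T\<^sub>t x, h R\<^sub>t\<^esub>(s)\<close>.  Hence the continuity of all
  translation maps of all orbit functions comes down to the continuity of
  \<open>t \<mapsto> g\<^bsub>T\<^sub>t x, h R\<^sub>t\<^esub>\<close>, and here finite-dimensionality enters.  The map \<open>t \<mapsto> R\<^sub>t\<close> is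
  norm continuous even if \<open>T\<close> is continuous only in the weak operator topology
  (\<open>continuous_R\<close>), because operators on \<open>Y\<close> are determined by finitely many scalars and
  inversion is continuous.  As \<open>g\<close> is bounded and bilinear in \<open>(x, h)\<close>, strong continuity of \<open>T\<close>
  makes the translation map norm continuous (\<open>orbit_fn_in_C_norm\<close>).  For weak continuity, expand
  \<open>h R\<^sub>t\<close> in finitely many coordinate functionals; a functional on the function space then
  turns the translation map into a finite sum of products of continuous functions
  (\<open>orbit_fn_in_C_weak\<close>).

  The invariant mean \<open>\<phi>\<close> can therefore be applied to every orbit function, and there is a
  unique \<open>P x\<close> in \<open>Y\<close> with \<open>h (P x) = \<phi> (g\<^bsub>x,h\<^esub>)\<close> for all \<open>h\<close>.  Linearity and boundedness are
  inherited from \<open>g\<close> and \<open>\<phi>\<close>, \<open>P\<close> fixes \<open>Y\<close> because \<open>g\<^bsub>y,h\<^esub>\<close> is constant for \<open>y\<close> in \<open>Y\<close>, and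
  invariance of \<open>\<phi>\<close> gives \<open>P T\<^sub>t = T\<^sub>t P\<close> (\<open>commuting_projection_by_averaging\<close>).

  A projection of minimal norm exists by compactness: closed balls of \<open>Y\<close> are compact, so by the
  theorem of Tychonoff the maps \<open>X \<rightarrow> Y\<close> with a given bound form a compact set for pointwise
  convergence, and being a commuting projection with a given bound on its norm is a pointwise
  closed condition (\<open>minimal_projection_exists\<close>).

  Everything is done with real scalars; linearity over the complex field is recovered at the end,
  because the average commutes with every operator that commutes with all \<open>R\<^sub>s T\<^sub>s\<close> and maps \<open>Y\<close>
  into itself.
\<close>

section \<open>Finite-dimensional subspaces of normed spaces\<close>

lemma compact_PiE_UNIV:
  fixes K :: "'a \<Rightarrow> 'b::topological_space set"
  assumes "\<And>x. compact (K x)"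
  shows "compact (PiE UNIV K)"
  using compactin_PiE[of "\<lambda>_. euclidean" UNIV K] assms
  by (simp add: euclidean_product_topology)

text \<open>
  All norms on a finite-dimensional space are equivalent.  Coefficient families are taken in the
  function space \<open>'x \<Rightarrow> real\<close>, whose boxes are compact by the theorem of Tychonoff; the families
  in \<open>[-1, 1]\<close> whose \<open>\<ell>\<^sup>1\<close> norm over \<open>B\<close> is 1 form a compact set on which the norm of the linear
  combination is continuous and vanishes nowhere, so it has a positive minimum.
\<close>

lemma sum_coefficients_le_norm:
  fixes B :: "'x::real_normed_vector set"
  assumes fin: "finite B" and ind: "independent B"
  shows "\<exists>m>0. \<forall>a. m * (\<Sum>b\<in>B. \<bar>a b\<bar>) \<le> norm (\<Sum>b\<in>B. a b *\<^sub>R b)"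
proof (cases "B = {}")
  case True
  then show ?thesis by (auto intro!: exI[of _ 1])
next
  case False
  define box where "box = (PiE UNIV (\<lambda>_. {-1..1}) :: ('x \<Rightarrow> real) set)"
  define K where "K = box \<inter> {a. (\<Sum>b\<in>B. \<bar>a b\<bar>) = 1}"
  have ev: "continuous_on UNIV (\<lambda>a::'x \<Rightarrow> real. a b)" for b
    by (rule continuous_on_product_coordinates)
  have "compact box"
    unfolding box_def by (intro compact_PiE_UNIV) simp
  moreover have "closed {a::'x \<Rightarrow> real. (\<Sum>b\<in>B. \<bar>a b\<bar>) = 1}"
    by (intro closed_Collect_eq continuous_intros ev)
  ultimately have "compact K"
    unfolding K_def by (rule compact_Int_closed)
  moreover obtain b0 where b0: "b0 \<in> B" using False by blast
  then have "(\<lambda>b. if b = b0 then 1 else 0) \<in> K"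
    using fin by (auto simp: K_def box_def if_distrib sum.delta cong: if_cong)
  then have "K \<noteq> {}" by blast
  moreover have "continuous_on K (\<lambda>a. norm (\<Sum>b\<in>B. a b *\<^sub>R b))"
    by (intro continuous_intros continuous_on_subset[OF ev]) auto
  ultimately obtain a0 where a0: "a0 \<in> K"
    and min: "\<And>a. a \<in> K \<Longrightarrow> norm (\<Sum>b\<in>B. a0 b *\<^sub>R b) \<le> norm (\<Sum>b\<in>B. a b *\<^sub>R b)"
    using continuous_attains_inf[of K "\<lambda>a. norm (\<Sum>b\<in>B. a b *\<^sub>R b)"] by blast
  define m where "m = norm (\<Sum>b\<in>B. a0 b *\<^sub>R b)"
  have "(\<Sum>b\<in>B. a0 b *\<^sub>R b) \<noteq> 0"
  proof
    assume "(\<Sum>b\<in>B. a0 b *\<^sub>R b) = 0"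
    then have "\<forall>b\<in>B. a0 b = 0"
      using ind fin by (metis independentD order_refl)
    with a0 show False by (simp add: K_def)
  qed
  then have "m > 0" by (simp add: m_def)
  moreover have "m * (\<Sum>b\<in>B. \<bar>a b\<bar>) \<le> norm (\<Sum>b\<in>B. a b *\<^sub>R b)" for a
  proof (cases "(\<Sum>b\<in>B. \<bar>a b\<bar>) = 0")
    case True
    then show ?thesis by simp
  next
    case False
    define N where "N = (\<Sum>b\<in>B. \<bar>a b\<bar>)"
    have "N \<ge> 0" unfolding N_def by (intro sum_nonneg) simp
    with False have N: "N > 0" unfolding N_def by linarith
    define a' where "a' b = (if b \<in> B then a b / N else 0)" for b
    have le: "\<bar>a b\<bar> \<le> N" if "b \<in> B" for b
      unfolding N_def using fin that by (intro member_le_sum) auto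
    have "a' \<in> box"
      using le N by (auto simp: box_def a'_def abs_le_iff divide_le_eq le_divide_eq; fastforce)
    moreover have "(\<Sum>b\<in>B. \<bar>a' b\<bar>) = 1"
      using N by (simp add: a'_def flip: sum_divide_distrib N_def)
    ultimately have "a' \<in> K" by (simp add: K_def)
    from min[OF this] have "m \<le> norm (\<Sum>b\<in>B. a' b *\<^sub>R b)" by (simp add: m_def)
    also have "(\<Sum>b\<in>B. a' b *\<^sub>R b) = (1 / N) *\<^sub>R (\<Sum>b\<in>B. a b *\<^sub>R b)"
      by (simp add: a'_def scaleR_sum_right)
    finally have "m \<le> norm (\<Sum>b\<in>B. a b *\<^sub>R b) / N" using N by simp
    then show ?thesis using N by (simp add: pos_le_divide_eq N_def)
  qed
  ultimately show ?thesis by blast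
qed

text \<open>
  A substitute for compactness of balls in \<open>span B\<close> that does not require \<open>span B\<close> to be closed
  first: the image of a coefficient box serves equally well.
\<close>

lemma compact_span_ball_superset:
  fixes B :: "'x::real_normed_vector set"
  assumes "finite B" and "independent B"
  obtains K where "compact K" "K \<subseteq> span B" "{y \<in> span B. norm y \<le> c} \<subseteq> K"
proof -
  obtain m where m: "m > 0"
    "\<And>a. m * (\<Sum>b\<in>B. \<bar>a b\<bar>) \<le> norm (\<Sum>b\<in>B. a b *\<^sub>R b)"
    using sum_coefficients_le_norm[OF assms] by metis
  define box where "box = (PiE UNIV (\<lambda>_. {-(c/m)..c/m}) :: ('x \<Rightarrow> real) set)"
  define K where "K = (\<lambda>a. \<Sum>b\<in>B. a b *\<^sub>R b) ` box"
  show ?thesis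
  proof (rule that)
    have "compact box"
      unfolding box_def by (intro compact_PiE_UNIV) simp
    then show "compact K"
      unfolding K_def
      by (rule compact_continuous_image[rotated])
        (intro continuous_intros continuous_on_subset[OF continuous_on_product_coordinates subset_UNIV])
    show "K \<subseteq> span B"
      by (auto simp: K_def intro!: span_sum intro: span_scale span_base)
    show "{y \<in> span B. norm y \<le> c} \<subseteq> K"
    proof safe
      fix y assume y: "y \<in> span B" "norm y \<le> c"
      then obtain u where u: "y = (\<Sum>b\<in>B. u b *\<^sub>R b)"
        using span_finite[OF assms(1)] by auto
      define a where "a b = (if b \<in> B then u b else 0)" for b
      have "\<bar>a b\<bar> \<le> c / m" for b
      proof (cases "b \<in> B")
        case True
        have "m * \<bar>u b\<bar> \<le> m * (\<Sum>b\<in>B. \<bar>u b\<bar>)"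
          using m(1) True assms(1) by (intro mult_left_mono member_le_sum) auto
        also have "\<dots> \<le> c" using m(2)[of u] u y(2) by simp
        finally show ?thesis using True m(1) by (simp add: a_def pos_le_divide_eq mult.commute)
      next
        case False
        have "0 \<le> c" using y(2) norm_ge_zero[of y] by linarith
        then show ?thesis using False m(1) by (simp add: a_def)
      qed
      then have "a b \<in> {-(c/m)..c/m}" for b
        by (metis abs_le_iff atLeastAtMost_iff neg_le_iff_le minus_minus)
      then have "a \<in> box" by (auto simp: box_def)
      moreover have "y = (\<Sum>b\<in>B. a b *\<^sub>R b)" by (simp add: u a_def)
      ultimately show "y \<in> K" by (auto simp: K_def)
    qed
  qed
qed

text \<open>
  Composing the coordinates of a finite-dimensional space with an operator into it makes them
  functionals on the whole space.  This takes the place of a Hahn-Banach extension.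
\<close>

lemma coordinate_functionals:
  fixes Q :: "'x::real_normed_vector \<Rightarrow>\<^sub>L 'x"
  assumes fin: "finite B" and ind: "independent B" and Q: "range (blinfun_apply Q) \<subseteq> span B"
  shows "\<exists>e :: 'x \<Rightarrow> 'x \<Rightarrow>\<^sub>L real. \<forall>x. Q x = (\<Sum>b\<in>B. e b x *\<^sub>R b)"
proof -
  obtain m where m: "m > 0"
    "\<And>a. m * (\<Sum>b\<in>B. \<bar>a b\<bar>) \<le> norm (\<Sum>b\<in>B. a b *\<^sub>R b)"
    using sum_coefficients_le_norm[OF fin ind] by metis
  define r where "r b x = representation B (Q x) b" for b x
  have Qr: "Q x = (\<Sum>b\<in>B. r b x *\<^sub>R b)" for x
    using sum_representation_eq[OF ind _ fin order_refl, of "Q x"] Q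
    by (simp add: r_def image_subset_iff)
  have "bounded_linear (r b)" if b: "b \<in> B" for b
  proof (rule bounded_linear_intro[where K = "norm Q / m"])
    show "r b (x + y) = r b x + r b y" for x y
      using ind Q by (simp add: r_def blinfun.add_right representation_add image_subset_iff)
    show "r b (c *\<^sub>R x) = c *\<^sub>R r b x" for c x
      using ind Q by (simp add: r_def blinfun.scaleR_right representation_scale image_subset_iff)
    show "norm (r b x) \<le> norm x * (norm Q / m)" for x
    proof -
      have "m * \<bar>r b x\<bar> \<le> m * (\<Sum>b\<in>B. \<bar>r b x\<bar>)"
        using m(1) fin b by (intro mult_left_mono member_le_sum) auto
      also have "\<dots> \<le> norm (Q x)" using m(2)[of "\<lambda>b. r b x"] Qr by simp
      also have "\<dots> \<le> norm Q * norm x" by (rule norm_blinfun)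
      finally show ?thesis using m(1) by (simp add: field_simps)
    qed
  qed
  then have "Q x = (\<Sum>b\<in>B. Blinfun (r b) x *\<^sub>R b)" for x
    by (simp add: bounded_linear_Blinfun_apply Qr)
  then show ?thesis by (intro exI[of _ "\<lambda>b. Blinfun (r b)"]) simp
qed

text \<open>
  The image of a basis spans, so it contains a basis; having the same cardinality, the image is
  itself a basis and no two of its members coincide.
\<close>

lemma surj_on_finite_dim_imp_inj_on:
  fixes f :: "'x::real_vector \<Rightarrow> 'x"
  assumes lin: "linear f" and fin: "finite B" and ind: "independent B"
    and surj: "f ` span B = span B"
  shows "inj_on f (span B)"
proof -
  have sp: "span (f ` B) = span B"
    using surj by (simp add: linear_span_image[OF lin])
  obtain C where C: "C \<subseteq> f ` B" "independent C" "f ` B \<subseteq> span C"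
    using maximal_independent_subset by blast
  have "span C = span B"
    using C sp by (metis span_mono span_span subset_antisym)
  then have "card C = card B"
    using C(2) ind by (metis dim_span_eq_card_independent)
  moreover have "card C \<le> card (f ` B)" "card (f ` B) \<le> card B"
    using C(1) fin by (auto intro: card_mono card_image_le)
  ultimately have "card C = card (f ` B)" and card: "card (f ` B) = card B"
    by linarith+
  then have "C = f ` B"
    using C(1) fin by (intro card_subset_eq) auto
  then have "independent (f ` B)" "inj_on f B"
    using C(2) fin card by (auto intro: eq_card_imp_inj_on)
  then show ?thesis
    using linear_inj_on_span_iff_independent_image[OF lin] by blast
qed

lemma real_or_complex_cases:
  obtains "\<And>z::'k::real_or_complex. \<exists>a. z = of_real a"
  | i where "i * i = (-1::'k)" "\<And>z. \<exists>a b. z = of_real a + of_real b * i"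
      "\<And>a b. norm (of_real a + of_real b * i) = sqrt (a\<^sup>2 + b\<^sup>2)"
  using real_or_complex[where 'a = 'k] by (fastforce simp: of_real_def)

lemma banach_scalingD:
  assumes "banach_scaling sc"
  shows "vector_space sc" and "sc (of_real r) x = r *\<^sub>R x" and "norm (sc c x) = norm c * norm x"
    and "sc c (x + y) = sc c x + sc c y" and "sc (c + d) x = sc c x + sc d x"
    and "sc c (sc d x) = sc (c * d) x"
proof -
  show v: "vector_space sc" and "sc (of_real r) x = r *\<^sub>R x" and "norm (sc c x) = norm c * norm x"
    using assms by (auto simp: banach_scaling_def)
  show "sc c (x + y) = sc c x + sc c y" and "sc (c + d) x = sc c x + sc d x"
    and "sc c (sc d x) = sc (c * d) x"
    using vector_space.vector_space_assms[OF v] by auto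
qed

lemma bounded_linear_scaling:
  assumes "banach_scaling sc"
  shows "bounded_linear (sc c)"
proof (rule bounded_linear_intro[where K = "norm c"])
  note s = banach_scalingD[OF assms]
  show "sc c (x + y) = sc c x + sc c y" for x y by (rule s(4))
  show "sc c (r *\<^sub>R x) = r *\<^sub>R sc c x" for r x
    by (metis s(2) s(6) mult.commute)
  show "norm (sc c x) \<le> norm x * norm c" for x
    by (simp add: s(3) mult.commute)
qed

text \<open>
  If \<open>C\<close> spans over the complex numbers, then \<open>C\<close> together with \<open>i C\<close> spans over the reals.
\<close>

lemma finite_dim_subspace_real_basis:
  fixes sc :: "'k::real_or_complex \<Rightarrow> 'x::banach \<Rightarrow> 'x"
  assumes X: "banach_scaling sc" and Y: "finite_dim_subspace sc Y"
  obtains B where "finite B" "independent B" "span B = Y"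
proof -
  note s = banach_scalingD[OF X]
  interpret k: vector_space sc by (rule s(1))
  obtain C where C: "finite C" "k.span C = Y"
    using Y by (auto simp: finite_dim_subspace_def)
  have sub: "subspace Y"
    using k.subspace_span[of C] s(2)[symmetric]
    by (simp add: C subspace_def k.subspace_def)
  have "\<exists>D. finite D \<and> span D = Y"
  proof (rule real_or_complex_cases[where 'k = 'k])
    assume re: "\<And>z::'k. \<exists>a. z = of_real a"
    have "k.subspace (span C)"
      unfolding k.subspace_def using re by (metis s(2) span_0 span_add span_scale)
    then have "Y \<subseteq> span C"
      using C(2) by (metis k.span_minimal span_superset)
    moreover have "span C \<subseteq> Y"
      using sub C(2) k.span_superset by (metis span_minimal)
    ultimately show ?thesis using C(1) by blast
  next
    fix i :: 'k
    assume i: "i * i = -1" "\<And>z. \<exists>a b. z = of_real a + of_real b * i"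
    define D where "D = C \<union> sc i ` C"
    have lin: "linear (sc i)"
      by (rule bounded_linear.linear[OF bounded_linear_scaling[OF X]])
    have "sc i ` D \<subseteq> span D"
    proof
      fix y assume "y \<in> sc i ` D"
      then consider c where "c \<in> C" "y = sc i c" | c where "c \<in> C" "y = sc i (sc i c)"
        by (auto simp: D_def)
      then show "y \<in> span D"
      proof cases
        case 1
        then show ?thesis by (auto simp: D_def intro: span_base)
      next
        case 2
        have "y = (-1) *\<^sub>R c"
          using s(2)[of "-1" c] by (simp add: 2 s(6) i)
        moreover have "c \<in> span D" using 2 by (auto simp: D_def intro: span_base)
        ultimately show ?thesis using span_scale by blast
      qed
    qed
    then have "sc i ` span D \<subseteq> span D"
      by (metis linear_span_image[OF lin] span_minimal subspace_span)
    then have i_span: "sc i x \<in> span D" if "x \<in> span D" for x using that by blast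
    have "sc z x \<in> span D" if x: "x \<in> span D" for z x
    proof -
      obtain a b where "z = of_real a + of_real b * i" using i(2) by blast
      then have "sc z x = a *\<^sub>R x + b *\<^sub>R sc i x"
        by (simp only: s(5) s(2) s(6)[symmetric])
      then show ?thesis using x i_span by (simp add: span_add span_scale)
    qed
    then have "k.subspace (span D)"
      by (simp add: k.subspace_def span_0 span_add)
    then have "Y \<subseteq> span D"
      unfolding C(2)[symmetric] by (rule k.span_minimal[rotated]) (auto simp: D_def intro: span_base)
    moreover have "D \<subseteq> Y"
      unfolding C(2)[symmetric] by (auto simp: D_def intro: k.span_base k.span_scale)
    then have "span D \<subseteq> Y"
      using sub by (simp add: span_minimal)
    moreover have "finite D" using C(1) by (simp add: D_def)
    ultimately show ?thesis by blast
  qed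
  then obtain D where D: "finite D" "span D = Y" by blast
  obtain B where "B \<subseteq> D" "independent B" "D \<subseteq> span B"
    using maximal_independent_subset by blast
  then show ?thesis
    using that[of B] D by (metis finite_subset span_mono span_span subset_antisym)
qed

section \<open>Weak operator continuity\<close>

text \<open>
  A real-linear functional \<open>k\<close> is the real part of the complex-linear functional
  \<open>H x = k x - i k (i x)\<close>.  The domination suffices to transfer continuity from \<open>H\<close> to \<open>k\<close>, and
  unlike an identity with a real part it makes sense for both kinds of scalars.
\<close>

lemma functional_dominated_by_dual:
  fixes sc :: "'k::real_or_complex \<Rightarrow> 'x::banach \<Rightarrow> 'x" and k :: "'x \<Rightarrow>\<^sub>L real"
  assumes X: "banach_scaling sc"
  shows "\<exists>H\<in>dual_space sc. \<forall>x. \<bar>k x\<bar> \<le> norm (H x)"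
proof -
  note s = banach_scalingD[OF X]
  show ?thesis
  proof (rule real_or_complex_cases[where 'k = 'k])
    assume re: "\<And>z::'k. \<exists>a. z = of_real a"
    define H where "H = Blinfun (\<lambda>x. of_real (k x) :: 'k)"
    have H: "H x = of_real (k x)" for x
      unfolding H_def
      by (subst bounded_linear_Blinfun_apply)
        (auto intro!: bounded_linear_compose[OF bounded_linear_of_real] blinfun.bounded_linear_right)
    have "H (sc z x) = z * H x" for z x
      using re[of z] by (auto simp: H s(2) blinfun.scaleR_right)
    then have "H \<in> dual_space sc" by (simp add: dual_space_def)
    then show ?thesis by (rule bexI[rotated]) (simp add: H)
  next
    fix i :: 'k
    assume i: "i * i = -1" "\<And>z. \<exists>a b. z = of_real a + of_real b * i"
      "\<And>a b. norm (of_real a + of_real b * i) = sqrt (a\<^sup>2 + b\<^sup>2)"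
    define H where "H = Blinfun (\<lambda>x. of_real (k x) - of_real (k (sc i x)) * i)"
    have "bounded_linear (\<lambda>x. of_real (k x) - of_real (k (sc i x)) * i)"
      by (intro bounded_linear_sub bounded_linear_mult_const
          bounded_linear_compose[OF bounded_linear_of_real] blinfun.bounded_linear_right
          bounded_linear_compose[OF blinfun.bounded_linear_right] bounded_linear_scaling X)
    then have H: "H x = of_real (k x) - of_real (k (sc i x)) * i" for x
      by (simp add: H_def bounded_linear_Blinfun_apply)
    have ii: "i * (i * z) = - z" for z
      by (simp add: i(1) flip: mult.assoc)
    have Hi: "H (sc i x) = i * H x" for x
    proof -
      have "sc i (sc i x) = - x"
        using s(2)[of "-1" x] by (simp add: s(6) i(1))
      then show ?thesis
        by (simp add: H blinfun.minus_right ii algebra_simps)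
    qed
    have "H (sc z x) = z * H x" for z x
    proof -
      obtain a b where z: "z = of_real a + of_real b * i" using i(2) by blast
      then have "sc z x = a *\<^sub>R x + b *\<^sub>R sc i x"
        by (simp add: s(5) s(2) flip: s(6))
      then show ?thesis
        by (simp add: blinfun.add_right blinfun.scaleR_right Hi z scaleR_conv_of_real algebra_simps)
    qed
    then have "H \<in> dual_space sc" by (simp add: dual_space_def)
    moreover have "\<bar>k x\<bar> \<le> norm (H x)" for x
    proof -
      have "norm (H x) = sqrt ((k x)\<^sup>2 + (- k (sc i x))\<^sup>2)"
        using i(3)[of "k x" "- k (sc i x)"] by (simp add: H)
      then show ?thesis by (simp add: real_le_rsqrt)
    qed
    ultimately show ?thesis by blast
  qed
qed

lemma continuous_weak_operator_topology:
  fixes sc :: "'k::real_or_complex \<Rightarrow> 'x::banach \<Rightarrow> 'x"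
    and T :: "'s::topological_space \<Rightarrow> 'x \<Rightarrow>\<^sub>L 'x" and k :: "'x \<Rightarrow>\<^sub>L real"
  assumes X: "banach_scaling sc"
    and T: "continuous_map euclidean (weak_operator_topology sc) T"
  shows "continuous_on UNIV (\<lambda>s. k (T s x))"
proof -
  obtain H where H: "H \<in> dual_space sc" "\<And>x. \<bar>k x\<bar> \<le> norm (H x)"
    using functional_dominated_by_dual[OF X] by blast
  have op: "open ((\<lambda>s. H (T s x)) -` U)" if U: "open U" for U
  proof -
    let ?V = "{A. H (blinfun_apply A x) \<in> U}"
    have "openin euclidean (T -` ?V \<inter> topspace euclidean)"
      using T unfolding weak_operator_topology_def continuous_on_generated_topo_iff
      using H(1) U by blast
    then show ?thesis by (simp add: vimage_def)
  qed
  have "continuous_on UNIV (\<lambda>s. H (T s x))"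
    using op by (simp add: continuous_on_open_vimage)
  then have lim: "((\<lambda>s. H (T s x)) \<longlongrightarrow> H (T t x)) (at t)" for t
    by (simp add: continuous_on_def)
  have "((\<lambda>s. k (T s x)) \<longlongrightarrow> k (T t x)) (at t)" for t
  proof (rule LIM_zero_cancel, rule Lim_null_comparison)
    show "\<forall>\<^sub>F s in at t. norm (k (T s x) - k (T t x)) \<le> norm (H (T s x) - H (T t x))"
      using H(2) by (simp flip: blinfun.diff_right)
    show "((\<lambda>s. norm (H (T s x) - H (T t x))) \<longlongrightarrow> 0) (at t)"
      using lim[of t] LIM_zero tendsto_norm_zero by blast
  qed
  then show ?thesis by (simp add: continuous_on_def)
qed

section \<open>Orbit functions of the conjugated projections\<close>

text \<open>
  Inversion of operators is continuous, for inverses relative to an idempotent \<open>Q\<close>.  The resolvent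
  identity \<open>R\<^sub>s - R\<^sub>t = R\<^sub>s (A\<^sub>t - A\<^sub>s) R\<^sub>t\<close> first bounds \<open>R\<^sub>s\<close> near \<open>t\<close> and then shows that
  \<open>R\<^sub>s\<close> tends to \<open>R\<^sub>t\<close>.
\<close>

lemma continuous_on_partial_inverse:
  fixes A R :: "'s::topological_space \<Rightarrow> 'x::real_normed_vector \<Rightarrow>\<^sub>L 'x"
  assumes cont: "continuous_on UNIV A"
    and AR: "\<And>s. A s o\<^sub>L R s = Q" and RA: "\<And>s. R s o\<^sub>L A s = Q"
    and RQ: "\<And>s. R s o\<^sub>L Q = R s" and QR: "\<And>s. Q o\<^sub>L R s = R s"
  shows "continuous_on UNIV R"
proof -
  have "(R \<longlongrightarrow> R t) (at t)" for t
  proof -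
    define c where "c = norm (R t)"
    define d where "d s = norm (A t - A s)" for s
    have "(A \<longlongrightarrow> A t) (at t)" using cont by (simp add: continuous_on_def)
    then have "((\<lambda>s. norm (A t - A s)) \<longlongrightarrow> norm (A t - A t)) (at t)"
      by (intro tendsto_intros)
    then have d0: "(d \<longlongrightarrow> 0) (at t)" by (simp add: d_def[abs_def])
    have diff: "norm (R s - R t) \<le> norm (R s) * d s * c" for s
    proof -
      have "R s - R t = R s o\<^sub>L (A t - A s) o\<^sub>L R t"
      proof (rule blinfun_eqI)
        fix x
        have "R s (A t (R t x)) = R s x" "R s (A s (R t x)) = R t x"
          using arg_cong[OF AR[of t], of "\<lambda>f. f x"] arg_cong[OF RQ[of s], of "\<lambda>f. f x"]
            arg_cong[OF RA[of s], of "\<lambda>f. f (R t x)"] arg_cong[OF QR[of t], of "\<lambda>f. f x"]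
          by simp_all
        then show "(R s - R t) x = (R s o\<^sub>L (A t - A s) o\<^sub>L R t) x"
          by (simp add: blinfun.diff_left blinfun.diff_right)
      qed
      also have "norm \<dots> \<le> norm (R s o\<^sub>L (A t - A s)) * c"
        unfolding c_def by (rule norm_blinfun_compose)
      also have "\<dots> \<le> norm (R s) * d s * c"
        unfolding c_def d_def by (intro mult_right_mono norm_blinfun_compose) simp
      finally show ?thesis .
    qed
    \<comment> \<open>Once \<open>d s * c < 1/2\<close>, the bound \<open>diff\<close> can be absorbed and gives \<open>norm (R s) \<le> 2 * c\<close>.\<close>
    have "((\<lambda>s. d s * c) \<longlongrightarrow> 0 * c) (at t)" by (intro tendsto_intros d0)
    then have "\<forall>\<^sub>F s in at t. d s * c < 1/2" by (intro order_tendstoD) auto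
    then have "\<forall>\<^sub>F s in at t. norm (R s - R t) \<le> 2 * c * d s * c"
    proof eventually_elim
      case (elim s)
      have "norm (R s) * (d s * c) \<le> norm (R s) * (1/2)"
        using elim by (intro mult_left_mono) auto
      moreover have "norm (R s) \<le> norm (R s - R t) + c"
        using norm_triangle_sub[of "R s" "R t"] by (simp add: c_def)
      ultimately have "norm (R s) \<le> 2 * c" using diff[of s] by (simp add: mult.assoc)
      then have "norm (R s) * d s * c \<le> 2 * c * d s * c"
        by (intro mult_right_mono) (auto simp: c_def d_def)
      with diff[of s] show ?case by simp
    qed
    moreover have "((\<lambda>s. 2 * c * d s * c) \<longlongrightarrow> 2 * c * 0 * c) (at t)"
      by (intro tendsto_intros d0)
    then have "((\<lambda>s. 2 * c * d s * c) \<longlongrightarrow> 0) (at t)" by simp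
    ultimately show ?thesis
      by (intro LIM_zero_cancel[of R]) (rule Lim_null_comparison)
  qed
  then show ?thesis by (simp add: continuous_on_def)
qed

lemma rtrans_mult:
  assumes "f \<in> C_r"
  shows "rtrans f (s * t) = rtrans (rtrans f t) s"
  by (rule bcontfun_eqI) (simp add: apply_rtrans assms rtrans_in_C_r mult.assoc)

text \<open>
  Here \<open>Q\<close> is a projection onto the finite-dimensional subspace \<open>Y\<close> spanned by \<open>B\<close>, this
  subspace is invariant under every \<open>T\<^sub>s\<close>, and \<open>R\<^sub>s\<close> stands for \<open>(T\<^sub>s|\<^sub>Y)\<inverse> Q\<close>.  Describing \<open>R\<^sub>s\<close> by
  identities between operators on the whole space avoids operators that are defined on \<open>Y\<close> only.
  The conjugated projections are the products \<open>R\<^sub>s T\<^sub>s\<close>.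
\<close>

locale quasi_inverse_family =
  fixes T R :: "'s::{semigroup_mult,topological_space} \<Rightarrow> 'x::real_normed_vector \<Rightarrow>\<^sub>L 'x"
    and Q :: "'x \<Rightarrow>\<^sub>L 'x" and B :: "'x set" and e :: "'x \<Rightarrow> 'x \<Rightarrow>\<^sub>L real" and M :: real
  assumes T_mult: "\<And>s t. T (s * t) = T s o\<^sub>L T t"
    and Q_coordinates: "\<And>x. Q x = (\<Sum>b\<in>B. e b x *\<^sub>R b)"
    and Q_basis: "\<And>b. b \<in> B \<Longrightarrow> Q b = b"
    and Q_T_Q: "\<And>s x. Q (T s (Q x)) = T s (Q x)"
    and Q_R: "\<And>s x. Q (R s x) = R s x"
    and R_Q: "\<And>s x. R s (Q x) = R s x"
    and R_T_Q: "\<And>s x. R s (T s (Q x)) = Q x"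
    and T_R: "\<And>s x. T s (R s x) = Q x"
    and weakly_continuous: "\<And>(k :: 'x \<Rightarrow>\<^sub>L real) x. continuous_on UNIV (\<lambda>s. k (T s x))"
    and norm_R_T: "\<And>s. norm (R s o\<^sub>L T s) \<le> M"
begin

lemma R_mult: "R (s * t) = R t o\<^sub>L R s"
proof (rule blinfun_eqI)
  fix x
  have "Q x = T (s * t) (Q (R t (R s x)))"
    by (simp add: T_mult T_R Q_R)
  then have "R (s * t) (Q x) = Q (R t (R s x))"
    by (simp add: R_T_Q)
  then show "R (s * t) x = (R t o\<^sub>L R s) x"
    by (simp add: R_Q Q_R)
qed

lemma continuous_Q_T: "continuous_on UNIV (\<lambda>s. Q (T s x))"
  unfolding Q_coordinates by (intro continuous_intros weakly_continuous)

text \<open>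
  Weak continuity becomes norm continuity on a finite-dimensional invariant subspace: the values
  at the basis vectors stay in the subspace, where convergence is convergence of coordinates, and
  these finitely many values determine the operator.
\<close>

lemma continuous_T_compose_Q: "continuous_on UNIV (\<lambda>s. T s o\<^sub>L Q)"
proof -
  have "T s o\<^sub>L Q = (\<Sum>b\<in>B. blinfun_scaleR_left (Q (T s b)) o\<^sub>L e b)" for s
  proof (rule blinfun_eqI)
    fix x
    have "Q (T s b) = T s b" if "b \<in> B" for b
      using Q_T_Q[of s b] that by (simp add: Q_basis)
    then show "(T s o\<^sub>L Q) x = (\<Sum>b\<in>B. blinfun_scaleR_left (Q (T s b)) o\<^sub>L e b) x"
      by (simp add: Q_coordinates[of x] blinfun.sum_left blinfun.sum_right blinfun.scaleR_right)
  qed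
  moreover have "continuous_on UNIV (\<lambda>s. \<Sum>b\<in>B. blinfun_scaleR_left (Q (T s b)) o\<^sub>L e b)"
    by (intro continuous_intros continuous_on_sum continuous_Q_T
        bounded_linear.continuous_on[OF bounded_linear_blinfun_scaleR_left]
        bounded_bilinear.continuous_on[OF bounded_bilinear_blinfun_compose])
  ultimately show ?thesis by simp
qed

lemma continuous_R: "continuous_on UNIV R"
proof (rule continuous_on_partial_inverse[OF continuous_T_compose_Q])
  show "T s o\<^sub>L Q o\<^sub>L R s = Q" "R s o\<^sub>L (T s o\<^sub>L Q) = Q" "R s o\<^sub>L Q = R s" "Q o\<^sub>L R s = R s" for s
    by (rule blinfun_eqI; simp add: Q_R R_Q T_R R_T_Q)+
qed

definition orbit_fn :: "'x \<Rightarrow> ('x \<Rightarrow>\<^sub>L real) \<Rightarrow> 's \<Rightarrow>\<^sub>C real" where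
  "orbit_fn x h = Bcontfun (\<lambda>s. h (R s (T s x)))"

lemma abs_orbit_le:
  fixes h :: "'x \<Rightarrow>\<^sub>L real"
  shows "\<bar>h (R s (T s x))\<bar> \<le> M * norm x * norm h"
proof -
  have "norm (R s (T s x)) \<le> norm (R s o\<^sub>L T s) * norm x"
    using norm_blinfun[of "R s o\<^sub>L T s" x] by simp
  also have "\<dots> \<le> M * norm x"
    by (intro mult_right_mono norm_R_T) simp
  finally have "norm h * norm (R s (T s x)) \<le> norm h * (M * norm x)"
    by (intro mult_left_mono) auto
  moreover have "\<bar>h (R s (T s x))\<bar> \<le> norm h * norm (R s (T s x))"
    using norm_blinfun[of h] by simp
  ultimately show ?thesis by (simp add: mult_ac)
qed

text \<open>
  Continuity in \<open>s\<close> is clear after writing \<open>R\<^sub>s = R\<^sub>s Q\<close>: then \<open>Q (T\<^sub>s x)\<close> and \<open>R\<^sub>s\<close> are both norm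
  continuous, although \<open>T\<^sub>s x\<close> may be only weakly continuous.
\<close>

lemma apply_orbit_fn [simp]: "apply_bcontfun (orbit_fn x h) s = h (R s (T s x))"
proof -
  have "continuous_on UNIV (\<lambda>s. h (R s (Q (T s x))))"
    by (intro bounded_linear.continuous_on[OF blinfun.bounded_linear_right]
        bounded_bilinear.continuous_on[OF bounded_bilinear_blinfun_apply]
        continuous_R continuous_Q_T)
  then have "continuous_on UNIV (\<lambda>s. h (R s (T s x)))" by (simp add: R_Q)
  moreover have "bounded (range (\<lambda>s. h (R s (T s x))))"
    by (rule boundedI[of _ "M * norm x * norm h"]) (auto intro: abs_orbit_le)
  ultimately show ?thesis
    by (simp add: orbit_fn_def Bcontfun_inverse bcontfun_def)
qed

text \<open>
  The class of orbit functions is closed under right translation.  So continuity of \<open>g\<^sub>t\<close> needs no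
  separate argument, and continuity of \<open>s \<mapsto> g\<^bsub>st\<^esub>\<close> is continuity of \<open>s \<mapsto> k\<^sub>s\<close> for another
  orbit function \<open>k = g\<^sub>t\<close>.
\<close>

lemma orbit_fn_translate:
  "apply_bcontfun (orbit_fn x h) (s * t) = apply_bcontfun (orbit_fn (T t x) (h o\<^sub>L R t)) s"
  by (simp add: T_mult R_mult)

lemma orbit_fn_in_C_r: "orbit_fn x h \<in> C_r"
  unfolding C_r_def orbit_fn_translate mem_Collect_eq by (intro allI continuous_on_apply_bcontfun)

lemma rtrans_orbit_fn: "rtrans (orbit_fn x h) t = orbit_fn (T t x) (h o\<^sub>L R t)"
  by (rule bcontfun_eqI) (simp only: apply_rtrans[OF orbit_fn_in_C_r] orbit_fn_translate)

lemma bounded_bilinear_orbit_fn: "bounded_bilinear orbit_fn"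
proof
  show "\<exists>K. \<forall>x h. norm (orbit_fn x h) \<le> norm x * norm h * K"
  proof (intro exI allI)
    fix x h
    show "norm (orbit_fn x h) \<le> norm x * norm h * M"
      by (rule norm_bound) (use abs_orbit_le in \<open>simp add: algebra_simps\<close>)
  qed
qed (rule bcontfun_eqI; simp add: blinfun.bilinear_simps)+

lemmas orbit_fn_simps =
  bounded_bilinear.add_left[OF bounded_bilinear_orbit_fn]
  bounded_bilinear.add_right[OF bounded_bilinear_orbit_fn]
  bounded_bilinear.scaleR_left[OF bounded_bilinear_orbit_fn]
  bounded_bilinear.scaleR_right[OF bounded_bilinear_orbit_fn]

text \<open>
  The dependence of \<open>h R\<^sub>t\<close> on \<open>t\<close> is confined to finitely many scalar coefficients.
\<close>

lemma functional_compose_R: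
  fixes h :: "'x \<Rightarrow>\<^sub>L real"
  shows "h o\<^sub>L R t = (\<Sum>b\<in>B. h (R t b) *\<^sub>R e b)"
proof (rule blinfun_eqI)
  fix x
  have "h (R t (Q x)) = (\<Sum>b\<in>B. h (R t b) *\<^sub>R e b) x"
    by (subst Q_coordinates)
      (simp add: blinfun.sum_right blinfun.sum_left blinfun.scaleR_right blinfun.scaleR_left mult.commute)
  then show "(h o\<^sub>L R t) x = (\<Sum>b\<in>B. h (R t b) *\<^sub>R e b) x" by (simp add: R_Q)
qed

lemma orbit_fn_in_C_norm:
  assumes strong: "\<And>x. continuous_on UNIV (\<lambda>s. T s x)"
  shows "orbit_fn x h \<in> C_norm"
proof -
  have "continuous_map euclidean (top_of_set C_r) (\<lambda>s. rtrans (orbit_fn x h) s)" for x h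
  proof -
    have "continuous_on UNIV (\<lambda>s. orbit_fn (T s x) (h o\<^sub>L R s))"
      by (intro bounded_bilinear.continuous_on[OF bounded_bilinear_orbit_fn] strong
          bounded_bilinear.continuous_on[OF bounded_bilinear_blinfun_compose]
          continuous_R continuous_on_const)
    then show ?thesis
      by (auto simp: rtrans_orbit_fn continuous_map_in_subtopology orbit_fn_in_C_r)
  qed
  moreover have "rtrans (orbit_fn x h) (s * t) = rtrans (orbit_fn (T t x) (h o\<^sub>L R t)) s" for s t
    by (simp only: rtrans_mult[OF orbit_fn_in_C_r] rtrans_orbit_fn[of x h])
  ultimately show ?thesis
    by (simp add: C_norm_def orbit_fn_in_C_r)
qed

text \<open>
  For a bounded functional \<open>\<phi>\<close> on the function space, \<open>y \<mapsto> \<phi> (g\<^bsub>y,k\<^esub>)\<close> is a bounded functional on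
  \<open>X\<close>, hence continuous along \<open>s \<mapsto> T\<^sub>s x\<close>.  Expanding \<open>h R\<^sub>s\<close> in the coordinate functionals
  reduces the translation map to these.
\<close>

lemma orbit_fn_in_C_weak: "orbit_fn x h \<in> C_weak"
proof -
  have "continuous_map euclidean (weak_topology_on C_r) (\<lambda>s. rtrans (orbit_fn x h) s)" for x h
    unfolding weak_topology_on_def
  proof (rule continuous_on_generated_topo)
    fix U
    assume "U \<in> {{v \<in> C_r. \<phi> v \<in> V} | \<phi> V. \<phi> \<in> dual_on (C_r :: ('s \<Rightarrow>\<^sub>C real) set) \<and> open V}"
    then obtain \<phi> V where U: "U = {v \<in> C_r. \<phi> v \<in> V}" and V: "open V"
      and \<phi>: "\<phi> \<in> dual_on (C_r :: ('s \<Rightarrow>\<^sub>C real) set)" by blast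
    obtain N where N: "\<And>f. f \<in> C_r \<Longrightarrow> \<bar>\<phi> f\<bar> \<le> N * norm f"
      and add: "\<And>f g. f \<in> C_r \<Longrightarrow> g \<in> C_r \<Longrightarrow> \<phi> (f + g) = \<phi> f + \<phi> g"
      and scale: "\<And>r f. f \<in> C_r \<Longrightarrow> \<phi> (r *\<^sub>R f) = r * \<phi> f"
      using \<phi> unfolding dual_on_def by blast
    obtain K where K: "\<And>x h. norm (orbit_fn x h) \<le> norm x * norm h * K"
      using bounded_bilinear.bounded[OF bounded_bilinear_orbit_fn] by blast
    have bl: "bounded_linear (\<lambda>y. \<phi> (orbit_fn y k))" for k
    proof (rule bounded_linear_intro[where K = "\<bar>N\<bar> * (norm k * K)"])
      show "\<phi> (orbit_fn (y + z) k) = \<phi> (orbit_fn y k) + \<phi> (orbit_fn z k)" for y z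
        by (simp add: orbit_fn_simps add orbit_fn_in_C_r)
      show "\<phi> (orbit_fn (r *\<^sub>R y) k) = r *\<^sub>R \<phi> (orbit_fn y k)" for r y
        by (simp add: orbit_fn_simps scale orbit_fn_in_C_r)
      show "norm (\<phi> (orbit_fn y k)) \<le> norm y * (\<bar>N\<bar> * (norm k * K))" for y
      proof -
        have "norm (\<phi> (orbit_fn y k)) \<le> N * norm (orbit_fn y k)"
          using N[OF orbit_fn_in_C_r] by simp
        also have "\<dots> \<le> \<bar>N\<bar> * (norm y * norm k * K)"
          by (intro mult_mono K) auto
        finally show ?thesis by (simp add: algebra_simps)
      qed
    qed
    have lin: "linear (\<lambda>k. \<phi> (orbit_fn y k))" for y
      by (rule linearI) (simp_all add: orbit_fn_simps add scale orbit_fn_in_C_r)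
    have "\<phi> (rtrans (orbit_fn x h) s)
        = (\<Sum>b\<in>B. h (R s b) * Blinfun (\<lambda>y. \<phi> (orbit_fn y (e b))) (T s x))" for s
      by (simp add: rtrans_orbit_fn functional_compose_R linear_sum[OF lin] linear_cmul[OF lin]
          bounded_linear_Blinfun_apply[OF bl])
    moreover have "continuous_on UNIV
        (\<lambda>s. \<Sum>b\<in>B. h (R s b) * Blinfun (\<lambda>y. \<phi> (orbit_fn y (e b))) (T s x))"
      by (intro continuous_intros weakly_continuous
          bounded_linear.continuous_on[OF blinfun.bounded_linear_right]
          bounded_bilinear.continuous_on[OF bounded_bilinear_blinfun_apply] continuous_R)
    ultimately have "continuous_on UNIV (\<lambda>s. \<phi> (rtrans (orbit_fn x h) s))" by simp
    with V have "open ((\<lambda>s. \<phi> (rtrans (orbit_fn x h) s)) -` V)"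
      by (simp add: continuous_on_open_vimage)
    moreover have "rtrans (orbit_fn x h) -` U = (\<lambda>s. \<phi> (rtrans (orbit_fn x h) s)) -` V"
      by (auto simp: U rtrans_in_C_r orbit_fn_in_C_r)
    ultimately show "openin euclidean (rtrans (orbit_fn x h) -` U \<inter> topspace euclidean)"
      by simp
  next
    \<comment> \<open>The subbasis of the weak topology covers the whole space, by the preimage of \<open>UNIV\<close> under \<open>0\<close>.\<close>
    have "(\<lambda>_. 0) \<in> dual_on (C_r :: ('s \<Rightarrow>\<^sub>C real) set)"
      by (auto simp: dual_on_def intro: exI[of _ 0])
    then have "C_r \<in> {{v \<in> C_r. \<phi> v \<in> V} | \<phi> V. \<phi> \<in> dual_on (C_r :: ('s \<Rightarrow>\<^sub>C real) set) \<and> open V}"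
      by (intro CollectI exI[of _ "\<lambda>_. 0"] exI[of _ UNIV]) auto
    then show "rtrans (orbit_fn x h) ` topspace euclidean
        \<subseteq> \<Union> {{v \<in> C_r. \<phi> v \<in> V} | \<phi> V. \<phi> \<in> dual_on C_r \<and> open V}"
      using rtrans_in_C_r[OF orbit_fn_in_C_r] by blast
  qed
  moreover have "rtrans (orbit_fn x h) (s * t) = rtrans (orbit_fn (T t x) (h o\<^sub>L R t)) s" for s t
    by (simp only: rtrans_mult[OF orbit_fn_in_C_r] rtrans_orbit_fn[of x h])
  ultimately show ?thesis
    by (simp add: C_weak_def orbit_fn_in_C_r)
qed

end

section \<open>Averaging over an invariant mean\<close>

lemma mean_abs_le_norm:
  assumes "is_mean F \<phi>" and "f \<in> F"
  shows "\<bar>\<phi> f\<bar> \<le> norm f"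
proof -
  have "apply_bcontfun f s \<le> norm f" "- norm f \<le> apply_bcontfun f s" for s
    using norm_bounded[of f s] by (simp_all add: abs_le_iff minus_le_iff)
  then have "Sup (range (apply_bcontfun f)) \<le> norm f" "- norm f \<le> Inf (range (apply_bcontfun f))"
    by (auto intro!: cSup_least cInf_greatest)
  moreover have "Inf (range (apply_bcontfun f)) \<le> \<phi> f" "\<phi> f \<le> Sup (range (apply_bcontfun f))"
    using assms by (auto simp: is_mean_def)
  ultimately show ?thesis by simp
qed

locale mean_on_orbits = quasi_inverse_family +
  fixes F :: "('a \<Rightarrow>\<^sub>C real) set" and \<phi>
  assumes mean: "right_invariant_mean F \<phi>"
    and orbit_fn_in_F: "\<And>x h. orbit_fn x h \<in> F"
begin

text \<open>
  The weak integral of \<open>s \<mapsto> R\<^sub>s T\<^sub>s x\<close> against the mean, written in coordinates; the coordinate-free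
  characterisation is \<open>functional_average\<close>.
\<close>

definition average :: "'b \<Rightarrow> 'b" where
  "average x = (\<Sum>b\<in>B. \<phi> (orbit_fn x (e b)) *\<^sub>R b)"

lemma is_mean: "is_mean F \<phi>"
  using mean by (simp add: right_invariant_mean_def)

lemma mean_add: "f \<in> F \<Longrightarrow> g \<in> F \<Longrightarrow> \<phi> (f + g) = \<phi> f + \<phi> g"
  and mean_scale: "f \<in> F \<Longrightarrow> \<phi> (r *\<^sub>R f) = r * \<phi> f"
  using is_mean by (auto simp: is_mean_def)

lemma functional_average:
  fixes h :: "'b \<Rightarrow>\<^sub>L real"
  shows "h (average x) = \<phi> (orbit_fn x h)"
proof -
  have lin: "linear (\<lambda>k. \<phi> (orbit_fn x k))"
    by (rule linearI) (simp_all add: orbit_fn_simps mean_add mean_scale orbit_fn_in_F)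
  have "h (average x) = \<phi> (orbit_fn x (\<Sum>b\<in>B. h b *\<^sub>R e b))"
    by (simp add: average_def blinfun.sum_right blinfun.scaleR_right linear_sum[OF lin]
        linear_cmul[OF lin] mult.commute)
  also have "orbit_fn x (\<Sum>b\<in>B. h b *\<^sub>R e b) = orbit_fn x h"
  proof (rule bcontfun_eqI)
    fix s
    have "h (Q y) = (\<Sum>b\<in>B. h b *\<^sub>R e b) y" for y
      by (subst Q_coordinates) (simp add: blinfun.sum_right blinfun.sum_left blinfun.scaleR_right
          blinfun.scaleR_left mult.commute)
    from this[of "R s (T s x)"]
    show "apply_bcontfun (orbit_fn x (\<Sum>b\<in>B. h b *\<^sub>R e b)) s = apply_bcontfun (orbit_fn x h) s"
      by (simp add: Q_R)
  qed
  finally show ?thesis .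
qed

lemma Q_average: "Q (average x) = average x"
  by (simp add: average_def blinfun.sum_right blinfun.scaleR_right Q_basis)

lemma average_eqI:
  assumes "Q y = y" and "\<And>h :: 'b \<Rightarrow>\<^sub>L real. \<phi> (orbit_fn x h) = h y"
  shows "average x = y"
proof -
  have "Q (average x) = Q y"
    unfolding Q_coordinates by (simp add: functional_average assms)
  then show ?thesis by (simp add: Q_average assms)
qed

lemma average_on_range:
  assumes "Q x = x"
  shows "average x = x"
proof (rule average_eqI[OF assms])
  fix h :: "'b \<Rightarrow>\<^sub>L real"
  have "R s (T s x) = x" for s using R_T_Q[of s x] assms by simp
  then have "range (apply_bcontfun (orbit_fn x h)) = {h x}" by auto
  then show "\<phi> (orbit_fn x h) = h x"
    using is_mean orbit_fn_in_F[of x h] by (force simp: is_mean_def)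
qed

lemma bounded_linear_average: "bounded_linear average"
proof -
  obtain K where K: "\<And>x h. norm (orbit_fn x h) \<le> norm x * norm h * K"
    using bounded_bilinear.bounded[OF bounded_bilinear_orbit_fn] by blast
  have "bounded_linear (\<lambda>x. \<phi> (orbit_fn x h))" for h
  proof (rule bounded_linear_intro[where K = "norm h * K"])
    show "norm (\<phi> (orbit_fn x h)) \<le> norm x * (norm h * K)" for x
      using mean_abs_le_norm[OF is_mean orbit_fn_in_F[of x h]] K[of x h] by (simp add: mult.assoc)
  qed (simp_all add: orbit_fn_simps mean_add mean_scale orbit_fn_in_F)
  then show ?thesis
    unfolding average_def[abs_def]
    by (intro bounded_linear_sum bounded_linear_compose[OF bounded_linear_scaleR_left])
qed

text \<open>
  The translate by \<open>t\<close> of the orbit function for \<open>(x, h T\<^sub>t)\<close> is the one for \<open>(T\<^sub>t x, h)\<close>, as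
  \<open>T\<^sub>t R\<^sub>t = Q\<close>; so the invariance of the mean is exactly the commutation with \<open>T\<^sub>t\<close>.
\<close>

lemma average_T: "average (T t x) = T t (average x)"
proof (rule average_eqI)
  show "Q (T t (average x)) = T t (average x)"
    using Q_T_Q[of t "average x"] by (simp add: Q_average)
  fix h :: "'b \<Rightarrow>\<^sub>L real"
  have "rtrans (orbit_fn x (h o\<^sub>L T t)) t = orbit_fn (T t x) (h o\<^sub>L Q)"
    unfolding rtrans_orbit_fn by (rule arg_cong[where f = "orbit_fn _"]) (rule blinfun_eqI, simp add: T_R)
  also have "\<dots> = orbit_fn (T t x) h"
    by (rule bcontfun_eqI) (simp add: Q_R)
  finally have "\<phi> (orbit_fn (T t x) h) = \<phi> (orbit_fn x (h o\<^sub>L T t))"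
    using mean orbit_fn_in_F by (metis right_invariant_mean_def)
  also have "\<dots> = h (T t (average x))"
    using functional_average[of "h o\<^sub>L T t" x] by simp
  finally show "\<phi> (orbit_fn (T t x) h) = h (T t (average x))" .
qed

text \<open>
  Applied to multiplication by a scalar, this gives linearity over the complex field.
\<close>

lemma average_commute:
  assumes "\<And>s x. R s (T s (L x)) = L (R s (T s x))" and "\<And>x. Q x = x \<Longrightarrow> Q (L x) = L x"
    and L: "bounded_linear L"
  shows "average (L x) = L (average x)"
proof (rule average_eqI)
  show "Q (L (average x)) = L (average x)"
    by (intro assms(2) Q_average)
  fix h :: "'b \<Rightarrow>\<^sub>L real"
  have "orbit_fn (L x) h = orbit_fn x (h o\<^sub>L Blinfun L)"
    by (rule bcontfun_eqI) (simp add: assms(1) bounded_linear_Blinfun_apply L)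
  then show "\<phi> (orbit_fn (L x) h) = h (L (average x))"
    using functional_average[of "h o\<^sub>L Blinfun L" x] by (simp add: bounded_linear_Blinfun_apply L)
qed

end

text \<open>
  The inverse of \<open>T\<^sub>s\<close> on \<open>Y\<close> is needed at basis vectors only: the finite-rank operator
  with these values, composed with the coordinates of \<open>Q\<close>, is bounded by construction.  It agrees with
  \<open>inv_into Y T\<^sub>s \<circ> Q\<close> because \<open>T\<^sub>s\<close> is injective on \<open>Y\<close>.
\<close>

lemma commuting_projection_by_averaging:
  fixes sc :: "'k::real_or_complex \<Rightarrow> 'x::banach \<Rightarrow> 'x"
    and T :: "'s::{semigroup_mult,topological_space} \<Rightarrow> 'x \<Rightarrow>\<^sub>L 'x"
  assumes X: "banach_scaling sc"
    and T_op: "\<And>s. T s \<in> bounded_ops sc"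
    and T_hom: "\<And>s t. T (s * t) = T s o\<^sub>L T t"
    and fin: "finite B" and ind: "independent B" and B: "span B = Y"
    and amenable:
      "(strongly_right_amenable TYPE('s) \<and>
          continuous_map euclidean (weak_operator_topology sc) T) \<or>
       (weakly_right_amenable TYPE('s) \<and>
          continuous_map euclidean strong_operator_topology T)"
    and TY: "\<And>s. blinfun_apply (T s) ` Y = Y"
    and inj: "\<And>s. inj_on (blinfun_apply (T s)) Y"
    and Q: "is_projection sc Y Q"
    and bdd: "bdd_above (range (\<lambda>s. onorm (\<lambda>x. inv_into Y (T s) (Q (T s x)))))"
  shows "\<exists>P. is_projection sc Y P \<and> commutes_with_all T P"
proof -
  have QY: "Q x \<in> Y" and Qy: "y \<in> Y \<Longrightarrow> Q y = y" and Q_sc: "Q (sc c x) = sc c (Q x)" for x y c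
    using Q by (auto simp: is_projection_def bounded_ops_def)
  have T_sc: "T s (sc c x) = sc c (T s x)" for s c x
    using T_op[of s] by (simp add: bounded_ops_def)
  have TY': "T s y \<in> Y" if "y \<in> Y" for s y using TY[of s] that by blast
  have subY: "subspace Y" unfolding B[symmetric] by (rule subspace_span)
  have BY: "B \<subseteq> Y" unfolding B[symmetric] by (rule span_superset)
  obtain e :: "'x \<Rightarrow> 'x \<Rightarrow>\<^sub>L real" where e: "\<And>x. Q x = (\<Sum>b\<in>B. e b x *\<^sub>R b)"
    using coordinate_functionals[OF fin ind, of Q] QY unfolding B by blast
  define S where "S s = inv_into Y (blinfun_apply (T s))" for s
  have SY: "S s y \<in> Y" and TS: "T s (S s y) = y" if "y \<in> Y" for s y
    using that TY[of s] inv_into_into[of y "T s" Y] f_inv_into_f[of y "T s" Y] by (auto simp: S_def)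
  define R where "R s = (\<Sum>b\<in>B. blinfun_scaleR_left (S s b) o\<^sub>L e b)" for s
  have R_apply: "R s x = (\<Sum>b\<in>B. e b x *\<^sub>R S s b)" for s x
    by (simp add: R_def blinfun.sum_left)
  have RY: "R s x \<in> Y" for s x
    unfolding R_apply using SY BY by (intro subspace_sum[OF subY] subspace_scale[OF subY]) auto
  have TR: "T s (R s x) = Q x" for s x
    using TS BY by (simp add: R_apply e blinfun.sum_right blinfun.scaleR_right subset_iff)
  have eqI: "y = z" if "y \<in> Y" "z \<in> Y" "T s y = T s z" for s y z
    using inj_onD[OF inj] that by blast
  have RS: "R s x = S s (Q x)" for s x
    by (rule eqI[of _ _ s]) (simp_all add: RY SY QY TR TS)
  have R_sc: "R s (sc c x) = sc c (R s x)" for s c x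
  proof (rule eqI)
    show "sc c (R s x) \<in> Y"
      using QY[of "sc c (R s x)"] RY[of s x] by (simp add: Q_sc Qy)
    show "T s (R s (sc c x)) = T s (sc c (R s x))"
      by (simp add: TR T_sc Q_sc)
  qed (rule RY)
  have strong: "continuous_on UNIV (\<lambda>s. T s x)"
    if "continuous_map euclidean strong_operator_topology T" for x
    using that unfolding continuous_on_strong_operator_topo_iff_coordinatewise by simp
  have weak: "continuous_on UNIV (\<lambda>s. k (T s x))" for k :: "'x \<Rightarrow>\<^sub>L real" and x
    using amenable continuous_weak_operator_topology[OF X] strong
      bounded_linear.continuous_on[OF blinfun.bounded_linear_right] by blast
  obtain M where M: "\<And>s. onorm (\<lambda>x. S s (Q (T s x))) \<le> M"
    using bdd unfolding bdd_above_def S_def by auto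
  interpret quasi_inverse_family T R Q B e M
  proof
    show "norm (R s o\<^sub>L T s) \<le> M" for s
    proof -
      have "blinfun_apply (R s o\<^sub>L T s) = (\<lambda>x. S s (Q (T s x)))"
        by (simp add: fun_eq_iff RS)
      then show ?thesis using M[of s] by (simp add: norm_blinfun.rep_eq)
    qed
    show "R s (T s (Q x)) = Q x" for s x
      by (rule eqI[of _ _ s]) (simp_all add: RY QY TR Qy TY')
    show "R s (Q x) = R s x" for s x
      by (simp add: RS Qy QY)
    show "Q b = b" if "b \<in> B" for b
      using BY Qy that by blast
  qed (simp_all add: T_hom Qy QY TY' RY TR weak, rule e)
  obtain F :: "('s \<Rightarrow>\<^sub>C real) set" and \<phi>
    where mean: "right_invariant_mean F \<phi>" and F: "\<And>x h. orbit_fn x h \<in> F"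
  proof -
    from amenable show ?thesis
      using that orbit_fn_in_C_weak orbit_fn_in_C_norm[OF strong]
      unfolding strongly_right_amenable_def weakly_right_amenable_def by blast
  qed
  interpret mean_on_orbits T R Q B e M F \<phi>
    by unfold_locales (rule mean, rule F)
  define P where "P = Blinfun average"
  have P: "P x = average x" for x
    by (simp add: P_def bounded_linear_Blinfun_apply bounded_linear_average)
  have "average (sc c x) = sc c (average x)" for c x
    by (rule average_commute)
      (use Q_sc in \<open>simp_all add: R_sc T_sc bounded_linear_scaling[OF X]\<close>)
  moreover have "average x \<in> Y" for x
    using QY[of "average x"] by (simp add: Q_average)
  ultimately have "is_projection sc Y P"
    by (auto simp: is_projection_def bounded_ops_def P average_on_range Qy)
  moreover have "commutes_with_all T P"
    by (auto simp: commutes_with_all_def P average_T intro!: blinfun_eqI)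
  ultimately show ?thesis by blast
qed

section \<open>Projections of minimal norm\<close>

text \<open>
  Let \<open>r\<close> be the infimum of the norms.  For each \<open>\<rho> > r\<close>, the commuting projections with norm at
  most \<open>\<rho>\<close> form a nonempty set, closed for pointwise convergence.  These sets are nested, so
  inside a compact product of subsets of \<open>Y\<close> they have a common point, and its norm is at most \<open>r\<close>.
  Boundedness and linearity are pointwise conditions as well, hence the work takes place among
  arbitrary functions.
\<close>

lemma minimal_projection_exists:
  fixes sc :: "'k::real_or_complex \<Rightarrow> 'x::banach \<Rightarrow> 'x" and T :: "'s \<Rightarrow> 'x \<Rightarrow>\<^sub>L 'x"
  assumes X: "banach_scaling sc" and fin: "finite B" and ind: "independent B" and B: "span B = Y"
    and ex: "\<exists>P. is_projection sc Y P \<and> commutes_with_all T P"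
  shows "\<exists>P\<^sub>0. minimal_projection sc T Y P\<^sub>0"
proof -
  define \<P> where "\<P> = {P. is_projection sc Y P \<and> commutes_with_all T P}"
  define r where "r = Inf (norm ` \<P>)"
  have ne: "\<P> \<noteq> {}" using ex by (simp add: \<P>_def)
  have bdd: "bdd_below (norm ` \<P>)" by (rule bdd_belowI[of _ 0]) auto
  have r_le: "r \<le> norm P" if "P \<in> \<P>" for P
    unfolding r_def using bdd that by (intro cInf_lower) auto
  have r0: "0 \<le> r" unfolding r_def using ne by (intro cInf_greatest) auto
  define good where "good F \<longleftrightarrow> (\<forall>x y. F (x + y) = F x + F y) \<and> (\<forall>c x. F (sc c x) = sc c (F x)) \<and>
      (\<forall>y\<in>Y. F y = y) \<and> (\<forall>s x. F (T s x) = T s (F x))" for F :: "'x \<Rightarrow> 'x"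
  define C where "C \<rho> = {F. good F \<and> (\<forall>x. norm (F x) \<le> \<rho> * norm x)}" for \<rho>
  have "\<exists>K. compact K \<and> K \<subseteq> Y \<and> {y \<in> Y. norm y \<le> (r + 1) * norm x} \<subseteq> K" for x :: 'x
    using compact_span_ball_superset[OF fin ind] unfolding B by metis
  then obtain K :: "'x \<Rightarrow> 'x set"
    where K: "\<And>x. compact (K x)" "\<And>x. K x \<subseteq> Y"
      "\<And>x y. y \<in> Y \<Longrightarrow> norm y \<le> (r + 1) * norm x \<Longrightarrow> y \<in> K x"
    by (auto simp: subset_iff) metis
  have ev: "continuous_on UNIV (\<lambda>F::'x \<Rightarrow> 'x. F x)" for x
    by (rule continuous_on_product_coordinates)
  have "{F::'x \<Rightarrow> 'x. \<forall>y\<in>Y. F y = y} = (\<Inter>y\<in>Y. {F. F y = y})" by blast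
  then have closed_id: "closed {F::'x \<Rightarrow> 'x. \<forall>y\<in>Y. F y = y}"
    by (simp only:) (intro closed_INT ballI closed_Collect_eq ev continuous_on_const)
  have closed: "closed (C \<rho>)" for \<rho>
    unfolding C_def good_def
    by (intro closed_Collect_conj closed_Collect_all closed_Collect_eq closed_Collect_le
        closed_id continuous_intros ev
        bounded_linear.continuous_on[OF bounded_linear_scaling[OF X]]
        bounded_linear.continuous_on[OF blinfun.bounded_linear_right])
  have "PiE UNIV K \<inter> (\<Inter>\<rho>\<in>{r<..}. C \<rho>) \<noteq> {}"
  proof (rule compact_imp_fip_image)
    show "compact (PiE UNIV K)" by (rule compact_PiE_UNIV) (rule K)
    show "closed (C \<rho>)" for \<rho> by (rule closed)
    fix I assume I: "finite I" "I \<subseteq> {r<..}"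
    \<comment> \<open>Including \<open>r + 1\<close> covers empty \<open>I\<close> and ensures that the projection found lies in the
      product of the sets \<open>K x\<close>, which are chosen for the bound \<open>r + 1\<close>.\<close>
    define \<rho> where "\<rho> = Min (insert (r + 1) I)"
    have "\<rho> > r" unfolding \<rho>_def using I by (subst Min_gr_iff) auto
    then obtain P where P: "P \<in> \<P>" "norm P < \<rho>"
      using cInf_lessD[of "norm ` \<P>" \<rho>] ne by (auto simp: r_def)
    have le: "norm P \<le> \<rho>'" if "\<rho>' \<in> insert (r + 1) I" for \<rho>'
      using P(2) I(1) that by (auto simp: \<rho>_def intro: less_imp_le)
    have bd: "norm (P x) \<le> \<rho>' * norm x" if "\<rho>' \<in> insert (r + 1) I" for x \<rho>'
      using norm_blinfun[of P x] mult_right_mono[OF le[OF that], of "norm x"] by simp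
    have "good (blinfun_apply P)"
      unfolding good_def
    proof (intro conjI allI ballI)
      show "P (T s x) = T s (P x)" for s x
        using P(1) unfolding \<P>_def commutes_with_all_def
        by (metis (mono_tags, lifting) blinfun_apply_blinfun_compose mem_Collect_eq)
    qed (use P(1) in \<open>simp_all add: \<P>_def is_projection_def bounded_ops_def blinfun.add_right\<close>)
    moreover have "blinfun_apply P \<in> PiE UNIV K"
      using P(1) bd by (auto simp: \<P>_def is_projection_def intro!: K(3))
    ultimately show "PiE UNIV K \<inter> (\<Inter>\<rho>\<in>I. C \<rho>) \<noteq> {}"
      using bd by (auto simp: C_def)
  qed
  then obtain F where F: "F \<in> PiE UNIV K" "\<And>\<rho>. \<rho> > r \<Longrightarrow> F \<in> C \<rho>" by auto
  have good: "good F" using F(2)[of "r + 1"] by (simp add: C_def)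
  have F_le: "norm (F x) \<le> r * norm x" for x
  proof (cases "x = 0")
    case True
    then show ?thesis using F(2)[of "r + 1"] by (auto simp: C_def dest: spec[of _ x])
  next
    case False
    have "norm (F x) / norm x \<le> \<rho>" if "\<rho> > r" for \<rho>
      using F(2)[OF that] False by (simp add: C_def divide_le_eq)
    then have "norm (F x) / norm x \<le> r" by (rule dense_ge)
    then show ?thesis using False by (simp add: divide_le_eq)
  qed
  have "bounded_linear F"
  proof (rule bounded_linear_intro[where K = r])
    show "F (c *\<^sub>R x) = c *\<^sub>R F x" for c x
      using good banach_scalingD(2)[OF X] unfolding good_def by metis
  qed (use good F_le in \<open>auto simp: good_def mult.commute\<close>)
  then have P0: "blinfun_apply (Blinfun F) = F" by (rule bounded_linear_Blinfun_apply)
  have "is_projection sc Y (Blinfun F)"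
    using good F(1) K(2) by (auto simp: is_projection_def bounded_ops_def P0 good_def)
  moreover have "commutes_with_all T (Blinfun F)"
    using good by (auto simp: commutes_with_all_def good_def P0 intro!: blinfun_eqI)
  moreover have "norm (Blinfun F) \<le> r"
    by (rule norm_blinfun_bound) (auto simp: P0 r0 F_le)
  ultimately show ?thesis
    using r_le unfolding minimal_projection_def \<P>_def by (blast intro: order_trans)
qed

section \<open>Equivalence and minimality\<close>

theorem proposition4p5:
  fixes sc :: "'k::real_or_complex \<Rightarrow> 'x::banach \<Rightarrow> 'x"
    and T :: "'s::{semigroup_mult,topological_space} \<Rightarrow> 'x \<Rightarrow>\<^sub>L 'x"
    and Y :: "'x set"
  assumes X: "banach_scaling sc"
    and T_op: "\<And>s. T s \<in> bounded_ops sc"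
    and T_hom: "\<And>s t. T (s * t) = T s o\<^sub>L T t"
    and Y: "finite_dim_subspace sc Y"
    and amenable_fp0:
      "(strongly_right_amenable TYPE('s) \<and>
          continuous_map euclidean (weak_operator_topology sc) T) \<or>
       (weakly_right_amenable TYPE('s) \<and>
          continuous_map euclidean strong_operator_topology T)"
    and fp1: "\<And>s. blinfun_apply (T s) ` Y = Y"
  shows
    "((\<exists>P. is_projection sc Y P \<and> (\<forall>s. P o\<^sub>L T s = T s o\<^sub>L P)) \<longleftrightarrow>
      (\<exists>Q. is_projection sc Y Q \<and>
         bdd_above (range (\<lambda>s. onorm (\<lambda>x.
           inv_into Y (blinfun_apply (T s)) (blinfun_apply Q (blinfun_apply (T s) x))))))) \<and>
     ((\<exists>Q. is_projection sc Y Q \<and>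
         bdd_above (range (\<lambda>s. onorm (\<lambda>x.
           inv_into Y (blinfun_apply (T s)) (blinfun_apply Q (blinfun_apply (T s) x)))))) \<longrightarrow>
      (\<exists>P\<^sub>0. minimal_projection sc T Y P\<^sub>0))"
    (is "(?i \<longleftrightarrow> ?ii) \<and> (?ii \<longrightarrow> ?min)")
proof -
  obtain B where B: "finite B" "independent B" "span B = Y"
    using finite_dim_subspace_real_basis[OF X Y] .
  have inj: "inj_on (blinfun_apply (T s)) Y" for s
    using surj_on_finite_dim_imp_inj_on[of "T s" B] B fp1[of s]
    by (simp add: bounded_linear.linear blinfun.bounded_linear_right)
  have ?ii if i: ?i
  proof -
    obtain P where P: "is_projection sc Y P" and comm: "\<forall>s. P o\<^sub>L T s = T s o\<^sub>L P"
      using i by (elim exE conjE)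
    have PT: "inv_into Y (T s) (P (T s x)) = P x" for s x
    proof -
      have "P (T s x) = T s (P x)"
        using comm by (metis blinfun_apply_blinfun_compose)
      moreover have "P x \<in> Y" using P by (auto simp: is_projection_def)
      ultimately show ?thesis by (simp add: inj)
    qed
    have "bdd_above (range (\<lambda>s. onorm (\<lambda>x. inv_into Y (T s) (P (T s x)))))"
      unfolding PT by (rule bdd_aboveI[of _ "onorm P"]) auto
    with P show ?thesis by (intro exI[of _ P] conjI)
  qed
  moreover have ex: "\<exists>P. is_projection sc Y P \<and> commutes_with_all T P" if ii: ?ii
  proof -
    obtain Q where "is_projection sc Y Q"
      and "bdd_above (range (\<lambda>s. onorm (\<lambda>x. inv_into Y (T s) (Q (T s x)))))"
      using ii by (elim exE conjE)
    then show ?thesis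
      by (rule commuting_projection_by_averaging[OF X T_op T_hom B amenable_fp0 fp1 inj])
  qed
  moreover have ?i if ?ii
    using ex[OF that] by (simp only: commutes_with_all_def)
  moreover have ?min if ?ii
    by (rule minimal_projection_exists[OF X B ex[OF that]])
  ultimately show ?thesis by (intro conjI iffI impI)
qed

end
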